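(* Let $n\ge 1$ be an integer, let $\alpha\ge 0$ be an integer, and let $a_0,\dots,a_{n-1}\in\mathbb{C}$. Let $C_{n,\alpha}=\left[a_{(r-\alpha s)\bmod n}\right]_{r,s=0}^{n-1}$ be the associated $\alpha$-circulant matrix. Put $g=\gcd(n,\alpha)$, $n_\alpha=n/g$, and for $s=0,\dots,n-1$ let $d_s=\left|(D_n)_{s,s}\right|^2$, where $D_n=\mathrm{diag}(\sqrt{n}\,F_n^*\underline{a})$. Then the $n$ singular values (counted with multiplicity, in no particular order) of $C_{n,\alpha}$ are $$\sigma_j(C_{n,\alpha})=\sqrt{\sum_{l=1}^{g}d_{(l-1)n_\alpha+j}},\qquad j=0,1,\dots,n_\alpha-1,$$ $$\sigma_j(C_{n,\alpha})=0,\qquad j=n_\alpha,\dots,n-1.$$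
   Context: $F_n=\frac{1}{\sqrt n}\left[e^{-2\pi i jk/n}\right]_{j,k=0}^{n-1}$ is the Fourier matrix, $^*$ denotes conjugate transpose, and $\underline{a}=[a_0,\dots,a_{n-1}]^T$. Thus $(D_n)_{s,s}=\sum_{k=0}^{n-1}a_ke^{2\pi i ks/n}$ are the eigenvalues of the classical circulant matrix $C_n=[a_{(r-s)\bmod n}]_{r,s=0}^{n-1}$. Convention: $\gcd(n,0)=n$. The singular values of $B$ are the nonnegative square roots of the eigenvalues of $B^*B$. *)

theory Defs
  imports Complex_Main "Jordan_Normal_Form.Schur_Decomposition"
begin

definition alpha_circulant :: "nat \<Rightarrow> nat \<Rightarrow> (nat \<Rightarrow> complex) \<Rightarrow> complex mat" where
  "alpha_circulant n \<alpha> a = mat n n (\<lambda>(r, s). a (nat ((int r - int \<alpha> * int s) mod int n)))"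

definition fourier_mat :: "nat \<Rightarrow> complex mat" where
  "fourier_mat n = mat n n (\<lambda>(j, k).
     complex_of_real (1 / sqrt (real n)) *
     exp (- 2 * complex_of_real pi * \<i> * of_nat j * of_nat k / of_nat n))"

definition circulant_diag :: "nat \<Rightarrow> (nat \<Rightarrow> complex) \<Rightarrow> complex mat" where
  "circulant_diag n a =
     mat_diag n (\<lambda>s. (complex_of_real (sqrt (real n)) \<cdot>\<^sub>v
                        (mat_adjoint (fourier_mat n) *\<^sub>v vec n a)) $ s)"

(* S lists, with algebraic multiplicity, the nonnegative square roots of the eigenvalues of
   B^* B.  A relation rather than a function, so that no real part or branch of the
   square root has to be chosen; S is determined by B (see below). *)
definition is_singular_values :: "complex mat \<Rightarrow> real multiset \<Rightarrow> bool" where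
  "is_singular_values B S \<longleftrightarrow>
     (\<forall>\<sigma> \<in># S. 0 \<le> \<sigma>) \<and>
     {# complex_of_real (\<sigma>\<^sup>2). \<sigma> \<in># S #} = proots (char_poly (mat_adjoint B * B))"

lemma is_singular_values_unique:
  assumes "is_singular_values B S" "is_singular_values B T"
  shows "S = T"
proof -
  have "U = {# sqrt (Re z). z \<in># proots (char_poly (mat_adjoint B * B)) #}"
    if "is_singular_values B U" for U
  proof -
    have "{# sqrt (Re z). z \<in># {# complex_of_real (\<sigma>\<^sup>2). \<sigma> \<in># U #} #} = {# \<sigma>. \<sigma> \<in># U #}"
      unfolding multiset.map_comp
      by (rule image_mset_cong) (use that in \<open>auto simp: is_singular_values_def\<close>)
    with that show ?thesis
      by (simp add: is_singular_values_def)
  qed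
  with assms show ?thesis by metis
qed

end

theory Submission
  imports Defs "HOL-Library.Real_Mod"
begin

text \<open>With \<open>\<omega> = exp (2 \<pi> \<i> / n)\<close> and \<open>\<lambda>\<^sub>k\<close> the eigenvalues of the classical circulant matrix, the
  \<open>(s, t)\<close> entry of \<open>C\<^sup>* C\<close> is \<open>1/n \<Sum>\<^sub>k \<bar>\<lambda>\<^sub>k\<bar>\<^sup>2 \<omega> ^ (k \<alpha> (t - s))\<close>, i.e. \<open>C\<^sup>* C\<close> is the sum of the rank-one
  matrices \<open>\<bar>\<lambda>\<^sub>k\<bar>\<^sup>2 v v\<^sup>*\<close>, where \<open>v\<close> is the Fourier vector of frequency \<open>k \<alpha> mod n\<close>. This frequency
  depends only on \<open>k\<close> modulo \<open>n\<^sub>\<alpha>\<close>, and is injective in \<open>k < n\<^sub>\<alpha>\<close>. Grouping the terms by \<open>k mod n\<^sub>\<alpha>\<close>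
  thus diagonalizes \<open>C\<^sup>* C\<close> in the orthonormal Fourier basis.\<close>

section \<open>Powers of a primitive root of unity and their orthogonality\<close>

definition unity_power :: "nat \<Rightarrow> int \<Rightarrow> complex" where
  "unity_power n m = cis (2 * pi * of_int m / real n)"

lemma unity_power_add: "unity_power n (l + m) = unity_power n l * unity_power n m"
  by (simp add: unity_power_def cis_mult ring_distribs add_divide_distrib)

lemma unity_power_mult_nat: "unity_power n (int k * m) = unity_power n m ^ k"
  by (simp add: unity_power_def DeMoivre mult_ac)

text \<open>On the unit circle conjugation is inversion. Integer exponents express this directly and
  also make index differences available without truncation.\<close>

lemma cnj_unity_power: "cnj (unity_power n m) = unity_power n (- m)"
  by (simp add: unity_power_def cis_cnj)

lemma unity_power_eq_1_iff:
  assumes "n > 0"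
  shows "unity_power n m = 1 \<longleftrightarrow> int n dvd m"
proof -
  have "2 * pi * of_int m / real n = of_int k * (2 * pi) \<longleftrightarrow> m = int n * k" for k
  proof -
    have "2 * pi * of_int m / real n = of_int k * (2 * pi) \<longleftrightarrow>
        (of_int m :: real) = of_int (int n * k)"
      using assms by (auto simp: field_simps)
    then show ?thesis by (simp only: of_int_eq_iff)
  qed
  then show ?thesis
    by (simp add: unity_power_def cis_eq_1_iff dvd_def)
qed

lemma unity_power_cong:
  assumes "n > 0" "int n dvd l - m"
  shows "unity_power n l = unity_power n m"
  using unity_power_add[of n m "l - m"] assms unity_power_eq_1_iff[of n "l - m"] by simp

text \<open>A geometric sum whose ratio is an n-th root of unity: either the ratio is 1 or the sum
  telescopes to 0.\<close>

lemma sum_unity_power: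
  assumes "n > 0"
  shows "(\<Sum>k<n. unity_power n (int k * m)) = (if int n dvd m then of_nat n else 0)"
proof (cases "int n dvd m")
  case True
  then have "unity_power n m = 1"
    using assms by (simp add: unity_power_eq_1_iff)
  with True show ?thesis
    by (simp add: unity_power_mult_nat)
next
  case False
  then have "unity_power n m \<noteq> 1"
    using assms by (simp add: unity_power_eq_1_iff)
  moreover have "unity_power n m ^ n = 1"
    using assms by (simp flip: unity_power_mult_nat add: unity_power_eq_1_iff)
  ultimately show ?thesis
    using False by (simp add: unity_power_mult_nat geometric_sum)
qed

lemma sum_mod_shift:
  fixes f :: "nat \<Rightarrow> 'a::comm_monoid_add"
  assumes "n > 0"
  shows "(\<Sum>r<n. f (nat ((int r - c) mod int n))) = (\<Sum>p<n. f p)"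
  by (rule sum.reindex_bij_witness
      [where i = "\<lambda>p. nat ((int p + c) mod int n)" and j = "\<lambda>r. nat ((int r - c) mod int n)"])
    (use assms in \<open>auto simp: nat_less_iff mod_simps\<close>)

section \<open>Fourier sums and the entries of C* C\<close>

definition circulant_eigenvalue :: "nat \<Rightarrow> (nat \<Rightarrow> complex) \<Rightarrow> nat \<Rightarrow> complex" where
  "circulant_eigenvalue n a k = (\<Sum>p<n. a p * unity_power n (int k * int p))"

lemma mat_adjoint_index:
  assumes "i < dim_col A" "j < dim_row A"
  shows "mat_adjoint A $$ (i, j) = conjugate (A $$ (j, i))"
  using assms by (simp add: mat_adjoint_def mat_of_rows_index)

lemma mat_adjoint_dim [simp]:
  "dim_row (mat_adjoint A) = dim_col A" "dim_col (mat_adjoint A) = dim_row A"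
  by (simp_all add: mat_adjoint_def)

text \<open>The factor \<open>sqrt n\<close> cancels the normalization of the Fourier matrix, and
  the adjoint turns its negative exponents into positive ones.\<close>

lemma circulant_diag_index:
  assumes "s < n"
  shows "circulant_diag n a $$ (s, s) = circulant_eigenvalue n a s"
proof -
  have "sqrt (real n) \<noteq> 0" using assms by simp
  have entry: "cnj (fourier_mat n $$ (p, s)) =
      complex_of_real (1 / sqrt (real n)) * unity_power n (int s * int p)" if "p < n" for p
  proof -
    have "fourier_mat n $$ (p, s) =
        complex_of_real (1 / sqrt (real n)) * unity_power n (- (int s * int p))"
      using that assms by (simp add: fourier_mat_def unity_power_def cis_conv_exp mult_ac)
    then show ?thesis by (simp add: cnj_unity_power)
  qed
  have "circulant_diag n a $$ (s, s) = complex_of_real (sqrt (real n)) *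
      (\<Sum>p<n. cnj (fourier_mat n $$ (p, s)) * a p)"
    using assms
    by (simp add: circulant_diag_def mat_diag_def scalar_prod_def mat_adjoint_index
        fourier_mat_def lessThan_atLeast0)
  also have "\<dots> = circulant_eigenvalue n a s"
    using \<open>sqrt (real n) \<noteq> 0\<close>
    by (simp add: entry circulant_eigenvalue_def sum_distrib_left mult_ac)
  finally show ?thesis .
qed

text \<open>The Fourier transform of the power spectrum is the cyclic autocorrelation of
  \<open>a\<close>. The shifts \<open>u\<close> and \<open>v\<close> are arbitrary integers, so that
  multiples of \<alpha> can be inserted for them.\<close>

lemma circulant_correlation:
  assumes "n > 0"
  shows "(\<Sum>k<n. of_real ((cmod (circulant_eigenvalue n a k))\<^sup>2) * unity_power n (int k * (v - u))) =
    of_nat n * (\<Sum>r<n. cnj (a (nat ((int r - u) mod int n))) * a (nat ((int r - v) mod int n)))"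
proof -
  have norm_sq: "of_real ((cmod (circulant_eigenvalue n a k))\<^sup>2) =
      (\<Sum>p<n. \<Sum>q<n. cnj (a p) * a q * unity_power n (int k * (int q - int p)))" for k
  proof -
    have "of_real ((cmod (circulant_eigenvalue n a k))\<^sup>2) =
        cnj (circulant_eigenvalue n a k) * circulant_eigenvalue n a k"
      by (simp only: complex_norm_square mult.commute)
    also have "\<dots> = (\<Sum>p<n. \<Sum>q<n. (cnj (a p) * unity_power n (- (int k * int p))) *
        (a q * unity_power n (int k * int q)))"
      by (simp add: circulant_eigenvalue_def sum_product cnj_unity_power)
    also have "\<dots> = (\<Sum>p<n. \<Sum>q<n. cnj (a p) * a q * unity_power n (int k * (int q - int p)))"
      using unity_power_add[of n "- (int k * int _)" "int k * int _"]
      by (intro sum.cong refl) (simp add: algebra_simps)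
    finally show ?thesis .
  qed
  have inner: "(\<Sum>q<n. cnj (a p) * a q * (if int n dvd int q - int p + (v - u) then of_nat n else 0)) =
      of_nat n * (cnj (a p) * a (nat ((int p + u - v) mod int n)))" for p
  proof -
    \<comment> \<open>For each \<open>p\<close>, orthogonality leaves exactly one residue
      \<open>q\<close> in the double sum.\<close>
    have "int n dvd int q - int p + (v - u) \<longleftrightarrow> q = nat ((int p + u - v) mod int n)"
      if "q < n" for q
    proof -
      have "int n dvd int q - int p + (v - u) \<longleftrightarrow> int q mod int n = (int p + u - v) mod int n"
        by (simp add: mod_eq_dvd_iff algebra_simps)
      then show ?thesis using that assms by auto
    qed
    then have "(\<Sum>q<n. cnj (a p) * a q * (if int n dvd int q - int p + (v - u) then of_nat n else 0)) =
        (\<Sum>q<n. if q = nat ((int p + u - v) mod int n) then of_nat n * (cnj (a p) * a q) else 0)"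
      by (intro sum.cong refl) auto
    also have "\<dots> = of_nat n * (cnj (a p) * a (nat ((int p + u - v) mod int n)))"
      using assms by (simp add: nat_less_iff)
    finally show ?thesis .
  qed
  have "(\<Sum>k<n. of_real ((cmod (circulant_eigenvalue n a k))\<^sup>2) * unity_power n (int k * (v - u))) =
      (\<Sum>k<n. \<Sum>p<n. \<Sum>q<n. cnj (a p) * a q * unity_power n (int k * (int q - int p + (v - u))))"
    unfolding norm_sq by (simp add: sum_distrib_right unity_power_add distrib_left mult.assoc)
  also have "\<dots> = (\<Sum>p<n. \<Sum>k<n. \<Sum>q<n. cnj (a p) * a q * unity_power n (int k * (int q - int p + (v - u))))"
    by (rule sum.swap)
  also have "\<dots> = (\<Sum>p<n. \<Sum>q<n. \<Sum>k<n. cnj (a p) * a q * unity_power n (int k * (int q - int p + (v - u))))"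
    by (rule sum.cong[OF refl], rule sum.swap)
  also have "\<dots> = (\<Sum>p<n. of_nat n * (cnj (a p) * a (nat ((int p + u - v) mod int n))))"
    by (simp only: flip: sum_distrib_left) (simp only: sum_unity_power[OF assms] inner sum_distrib_left)
  \<comment> \<open>Substituting \<open>p = (r - u) mod n\<close> turns the surviving residue
    \<open>p + u - v\<close> into \<open>r - v\<close>.\<close>
  also have "\<dots> = (\<Sum>r<n. of_nat n * (cnj (a (nat ((int r - u) mod int n))) *
      a (nat ((int (nat ((int r - u) mod int n)) + u - v) mod int n))))"
    by (rule sum_mod_shift[OF assms, symmetric])
  also have "\<dots> = of_nat n * (\<Sum>r<n. cnj (a (nat ((int r - u) mod int n))) * a (nat ((int r - v) mod int n)))"
  proof -
    have "(int (nat ((int r - u) mod int n)) + u - v) mod int n = (int r - v) mod int n" for r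
    proof -
      have "(int (nat ((int r - u) mod int n)) + u - v) mod int n =
          ((int r - u) mod int n + (u - v)) mod int n"
        using assms by (simp add: add_diff_eq)
      also have "\<dots> = (int r - v) mod int n" by (simp add: mod_add_left_eq)
      finally show ?thesis .
    qed
    then show ?thesis by (simp only: sum_distrib_left)
  qed
  finally show ?thesis .
qed

lemma alpha_circulant_dim [simp]:
  "dim_row (alpha_circulant n \<alpha> a) = n" "dim_col (alpha_circulant n \<alpha> a) = n"
  by (simp_all add: alpha_circulant_def)

lemma adjoint_alpha_circulant_mult:
  assumes "s < n" "t < n"
  shows "(mat_adjoint (alpha_circulant n \<alpha> a) * alpha_circulant n \<alpha> a) $$ (s, t) =
    (\<Sum>k<n. of_real ((cmod (circulant_eigenvalue n a k))\<^sup>2) *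
      unity_power n (int k * (int \<alpha> * int t - int \<alpha> * int s))) / of_nat n"
proof -
  have "n > 0" using assms by simp
  have "(mat_adjoint (alpha_circulant n \<alpha> a) * alpha_circulant n \<alpha> a) $$ (s, t) =
      (\<Sum>r<n. cnj (a (nat ((int r - int \<alpha> * int s) mod int n))) *
        a (nat ((int r - int \<alpha> * int t) mod int n)))"
    using assms by (simp add: scalar_prod_def mat_adjoint_index alpha_circulant_def lessThan_atLeast0)
  then show ?thesis
    using \<open>n > 0\<close> by (simp only: circulant_correlation) simp
qed

section \<open>Grouping by residues, and the frequencies as a permutation\<close>

lemma sum_by_residue:
  fixes f :: "nat \<Rightarrow> 'a::comm_monoid_add"
  shows "(\<Sum>k<g * m. f k) = (\<Sum>j<m. \<Sum>l = 1..g. f ((l - 1) * m + j))"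
proof -
  have "(\<Sum>k<g * m. f k) = (\<Sum>l<g. \<Sum>k = l * m..<l * m + m. f k)"
    by (rule sum.nat_group[symmetric])
  also have "\<dots> = (\<Sum>l<g. \<Sum>j<m. f (l * m + j))"
  proof (rule sum.cong[OF refl])
    show "(\<Sum>k = l * m..<l * m + m. f k) = (\<Sum>j<m. f (l * m + j))" for l
      using sum.shift_bounds_nat_ivl[of f 0 "l * m" m]
      by (simp add: lessThan_atLeast0 add.commute)
  qed
  also have "\<dots> = (\<Sum>j<m. \<Sum>l<g. f (l * m + j))" by (rule sum.swap)
  \<comment> \<open>The shift of \<open>l\<close> by one matches the indexing in the formula for the
    singular values.\<close>
  also have "\<dots> = (\<Sum>j<m. \<Sum>l = 1..g. f ((l - 1) * m + j))"
    by (intro sum.cong refl sum.reindex_bij_witness[where i = "\<lambda>l. l - 1" and j = Suc]) auto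
  finally show ?thesis .
qed

text \<open>Dividing \<open>n\<close> and \<alpha> by their gcd leaves coprime \<open>m\<close> and
  \<open>b\<close>. Hence \<open>n\<close> divides \<open>(i - j) * \<alpha>\<close> only if
  \<open>m\<close> divides \<open>i - j\<close>, and \<open>i\<close>, \<open>j\<close> lie below
  \<open>m\<close>.\<close>

lemma inj_on_mult_mod:
  fixes n \<alpha> :: nat
  assumes "n > 0"
  shows "inj_on (\<lambda>j. j * \<alpha> mod n) {..<n div gcd n \<alpha>}"
proof (rule inj_onI)
  fix i j assume ij: "i \<in> {..<n div gcd n \<alpha>}" "j \<in> {..<n div gcd n \<alpha>}" "i * \<alpha> mod n = j * \<alpha> mod n"
  define c where "c = gcd n \<alpha>"
  define m where "m = n div c"
  define b where "b = \<alpha> div c"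
  have c: "c > 0" using assms by (simp add: c_def)
  have nm: "n = c * m" and \<alpha>b: "\<alpha> = c * b" by (simp_all add: m_def b_def c_def)
  have "coprime m b"
    unfolding m_def b_def c_def by (rule div_gcd_coprime) (use assms in simp)
  have "int (i * \<alpha>) mod int n = int (j * \<alpha>) mod int n"
    using ij(3) by (simp only: flip: of_nat_mod)
  then have "int n dvd (int i - int j) * int \<alpha>"
    by (simp add: mod_eq_dvd_iff left_diff_distrib)
  then have "int c * int m dvd int c * ((int i - int j) * int b)"
    unfolding nm \<alpha>b by (simp only: of_nat_mult mult.left_commute)
  then have "int m dvd (int i - int j) * int b"
    using c by simp
  then have "int m dvd int i - int j"
    using \<open>coprime m b\<close> by (simp add: coprime_dvd_mult_left_iff)
  then have "int i mod int m = int j mod int m" by (simp add: mod_eq_dvd_iff)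
  then show "i = j" using ij(1,2) by (simp add: m_def c_def flip: of_nat_mod)
qed

text \<open>The complements of \<open>A\<close> and of its image have equal size, so any bijection
  between them completes \<open>f\<close>. This will assign the remaining frequencies to the zero
  singular values.\<close>

lemma extend_inj_to_bij:
  assumes "finite B" "A \<subseteq> B" "inj_on f A" "f ` A \<subseteq> B"
  obtains h where "bij_betw h B B" "\<And>x. x \<in> A \<Longrightarrow> h x = f x"
proof -
  have "finite A" using assms finite_subset by blast
  have "card (B - A) = card (B - f ` A)"
    using assms \<open>finite A\<close> by (simp add: card_Diff_subset card_image)
  then obtain e where e: "bij_betw e (B - A) (B - f ` A)"
    using assms(1) finite_same_card_bij[of "B - A" "B - f ` A"] by auto
  define h where "h x = (if x \<in> A then f x else e x)" for x
  have "bij_betw h A (f ` A)"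
    using assms(3) by (simp add: bij_betw_def h_def inj_on_def)
  moreover have "bij_betw h (B - A) (B - f ` A)"
    using e by (rule bij_betw_cong[THEN iffD1, rotated]) (simp add: h_def)
  ultimately have "bij_betw h (A \<union> (B - A)) (f ` A \<union> (B - f ` A))"
    by (rule bij_betw_combine) auto
  then have "bij_betw h B B"
    using assms by (simp add: Un_absorb1)
  then show thesis by (rule that) (simp add: h_def)
qed

section \<open>Diagonalization in a permuted Fourier basis\<close>

lemma proots_char_poly_fourier_diagonal:
  fixes A :: "complex mat"
  assumes A: "A \<in> carrier_mat n n" and "n > 0" and h: "inj_on h {..<n}" "h ` {..<n} \<subseteq> {..<n}"
    and entries: "\<And>s t. s < n \<Longrightarrow> t < n \<Longrightarrow>
      A $$ (s, t) = (\<Sum>j<n. e j * unity_power n (int (h j) * (int t - int s))) / of_nat n"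
  shows "proots (char_poly A) = {# e j. j \<in># mset_set {0..<n} #}"
proof -
  \<comment> \<open>The rows of \<open>Q\<close> are Fourier vectors in the order given by
    \<open>h\<close>. Placing the whole factor 1/n in \<open>P\<close> makes \<open>P\<close> the
    inverse of \<open>Q\<close> and avoids square roots.\<close>
  define P where "P = mat n n (\<lambda>(s, j). unity_power n (- (int (h j) * int s)) / of_nat n)"
  define Q where "Q = mat n n (\<lambda>(j, t). unity_power n (int (h j) * int t))"
  have PQ: "P \<in> carrier_mat n n" "Q \<in> carrier_mat n n"
    by (simp_all add: P_def Q_def)
  have "Q * P = 1\<^sub>m n"
  proof (rule eq_matI)
    fix i j assume "i < dim_row (1\<^sub>m n)" "j < dim_col (1\<^sub>m n)"
    then have ij: "i < n" "j < n" by simp_all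
    have "(Q * P) $$ (i, j) =
        (\<Sum>k<n. unity_power n (int (h i) * int k) * unity_power n (- (int (h j) * int k))) / of_nat n"
      using ij by (simp add: P_def Q_def scalar_prod_def lessThan_atLeast0 sum_divide_distrib)
    also have "\<dots> = (\<Sum>k<n. unity_power n (int k * (int (h i) - int (h j)))) / of_nat n"
      by (simp add: algebra_simps flip: unity_power_add)
    also have "\<dots> = (if int n dvd int (h i) - int (h j) then 1 else 0)"
      using \<open>n > 0\<close> by (simp add: sum_unity_power)
    \<comment> \<open>Values of \<open>h\<close> on indices below \<open>n\<close> are themselves
      below \<open>n\<close>, so congruence modulo \<open>n\<close> is equality.\<close>
    also have "int n dvd int (h i) - int (h j) \<longleftrightarrow> h i = h j"
      using ij h(2) by (simp add: image_subset_iff flip: mod_eq_dvd_iff)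
    also have "\<dots> \<longleftrightarrow> i = j"
      using ij h(1) by (auto simp: inj_on_def)
    finally show "(Q * P) $$ (i, j) = 1\<^sub>m n $$ (i, j)" using ij by simp
  qed (simp_all add: P_def Q_def)
  then have "P * Q = 1\<^sub>m n" by (rule mat_mult_left_right_inverse[OF PQ(2,1)])
  moreover have "A = P * mat_diag n e * Q"
  proof (rule eq_matI)
    fix s t assume "s < dim_row (P * mat_diag n e * Q)" "t < dim_col (P * mat_diag n e * Q)"
    then have st: "s < n" "t < n" by (simp_all add: P_def Q_def)
    have "(P * mat_diag n e * Q) $$ (s, t) =
        (\<Sum>j<n. e j * (unity_power n (- (int (h j) * int s)) * unity_power n (int (h j) * int t))) / of_nat n"
      using st by (subst mat_diag_mult_right[OF PQ(1)])
        (simp add: P_def Q_def scalar_prod_def lessThan_atLeast0 sum_divide_distrib mult_ac)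
    also have "\<dots> = A $$ (s, t)"
      using st by (simp add: entries algebra_simps flip: unity_power_add)
    finally show "A $$ (s, t) = (P * mat_diag n e * Q) $$ (s, t)" by simp
  qed (use A PQ in auto)
  ultimately have "similar_mat A (mat_diag n e)"
    using A PQ \<open>Q * P = 1\<^sub>m n\<close> by (intro similar_matI[of _ _ P Q n]) auto
  then have "char_poly A = char_poly (mat_diag n e)" by (rule char_poly_similar)
  also have "\<dots> = (\<Prod>x\<leftarrow>diag_mat (mat_diag n e). [:- x, 1:])"
    by (rule char_poly_upper_triangular) (auto simp: mat_diag_def)
  also have "diag_mat (mat_diag n e) = map e [0..<n]"
    by (simp add: diag_mat_def mat_diag_def)
  also have "(\<Prod>x\<leftarrow>map e [0..<n]. [:- x, 1:]) = (\<Prod>j = 0..<n. [:- e j, 1:])"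
    using prod.distinct_set_conv_list[of "[0..<n]" "\<lambda>j. [:- e j, 1:]"] by (simp add: comp_def)
  finally have "proots (char_poly A) = (\<Sum>j\<in>{0..<n}. {# e j #})"
    by (simp add: proots_prod)
  also have "(\<Sum>j\<in>X. {# e j #}) = image_mset e (mset_set X)" if "finite X" for X
    using that by (induction X rule: finite_induct) auto
  finally show ?thesis by simp
qed

theorem mainTheorem1:
  fixes n \<alpha> :: nat and a :: "nat \<Rightarrow> complex"
  assumes "n \<ge> 1"
  defines "g \<equiv> gcd n \<alpha>"
  defines "n\<^sub>\<alpha> \<equiv> n div g"
  defines "d \<equiv> (\<lambda>s. (cmod (circulant_diag n a $$ (s, s)))\<^sup>2)"
  defines "\<sigma> \<equiv> (\<lambda>j. if j < n\<^sub>\<alpha> then sqrt (\<Sum>l = 1..g. d ((l - 1) * n\<^sub>\<alpha> + j)) else 0)"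
  shows "is_singular_values (alpha_circulant n \<alpha> a) {# \<sigma> j. j \<in># mset_set {0..<n} #}"
proof -
  have "n > 0" using assms(1) by simp
  have n: "n = g * n\<^sub>\<alpha>" by (simp add: n\<^sub>\<alpha>_def g_def)
  have "n\<^sub>\<alpha> \<le> n" by (simp add: n\<^sub>\<alpha>_def)
  \<comment> \<open>Increasing \<open>k\<close> by \<open>n\<^sub>\<alpha>\<close> changes the
    frequency \<open>k * \<alpha>\<close> by a multiple of \<open>n\<close>.\<close>
  have period: "int n dvd int n\<^sub>\<alpha> * int \<alpha>"
  proof -
    have "\<alpha> = g * (\<alpha> div g)" by (simp add: g_def)
    then have "n\<^sub>\<alpha> * \<alpha> = n * (\<alpha> div g)" using n by (metis mult.assoc mult.commute)
    then show ?thesis by (simp flip: of_nat_mult)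
  qed
  have d: "d k = (cmod (circulant_eigenvalue n a k))\<^sup>2" if "k < n" for k
    using that by (simp add: d_def circulant_diag_index)
  have d_nonneg: "d k \<ge> 0" for k by (simp add: d_def)
  have \<sigma>_sq: "(\<sigma> j)\<^sup>2 = (if j < n\<^sub>\<alpha> then (\<Sum>l = 1..g. d ((l - 1) * n\<^sub>\<alpha> + j)) else 0)" for j
    by (simp add: \<sigma>_def d_nonneg sum_nonneg)
  \<comment> \<open>From \<open>n\<^sub>\<alpha>\<close> on, any assignment of the frequencies left
    over will do, because their eigenvalues are 0.\<close>
  obtain h where h: "bij_betw h {..<n} {..<n}" "\<And>j. j \<in> {..<n\<^sub>\<alpha>} \<Longrightarrow> h j = j * \<alpha> mod n"
    by (rule extend_inj_to_bij[of "{..<n}" "{..<n\<^sub>\<alpha>}" "\<lambda>j. j * \<alpha> mod n"])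
      (use inj_on_mult_mod[OF \<open>n > 0\<close>, of \<alpha>] \<open>n\<^sub>\<alpha> \<le> n\<close> \<open>n > 0\<close> in \<open>auto simp: n\<^sub>\<alpha>_def g_def\<close>)
  let ?A = "mat_adjoint (alpha_circulant n \<alpha> a) * alpha_circulant n \<alpha> a"
  have entries: "?A $$ (s, t) =
      (\<Sum>j<n. complex_of_real ((\<sigma> j)\<^sup>2) * unity_power n (int (h j) * (int t - int s))) / of_nat n"
    if "s < n" "t < n" for s t
  proof -
    \<comment> \<open>All \<open>k\<close> in one residue class modulo
      \<open>n\<^sub>\<alpha>\<close> contribute the same Fourier vector, so their coefficients
      \<open>d k\<close> add up to the square of \<open>\<sigma> j\<close>.\<close>
    have collapse: "unity_power n (int (l * n\<^sub>\<alpha> + j) * (int \<alpha> * int t - int \<alpha> * int s)) =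
        unity_power n (int (h j) * (int t - int s))" if "j < n\<^sub>\<alpha>" for j l
    proof (rule unity_power_cong[OF \<open>n > 0\<close>])
      have "int n dvd int j * int \<alpha> - int (h j)"
        using h(2)[of j] that by (simp add: of_nat_mod minus_mod_eq_mult_div)
      with period have "int n dvd int l * (int n\<^sub>\<alpha> * int \<alpha>) + (int j * int \<alpha> - int (h j))"
        by (simp only: dvd_add dvd_mult)
      then have "int n dvd (int l * (int n\<^sub>\<alpha> * int \<alpha>) + (int j * int \<alpha> - int (h j))) * (int t - int s)"
        by (rule dvd_mult2)
      then show "int n dvd int (l * n\<^sub>\<alpha> + j) * (int \<alpha> * int t - int \<alpha> * int s) -
          int (h j) * (int t - int s)"
        by (simp add: algebra_simps)
    qed
    have "(\<Sum>k<n. of_real ((cmod (circulant_eigenvalue n a k))\<^sup>2) *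
          unity_power n (int k * (int \<alpha> * int t - int \<alpha> * int s))) =
        (\<Sum>k<n. of_real (d k) * unity_power n (int k * (int \<alpha> * int t - int \<alpha> * int s)))"
      by (simp add: d)
    also have "\<dots> = (\<Sum>k<g * n\<^sub>\<alpha>. of_real (d k) * unity_power n (int k * (int \<alpha> * int t - int \<alpha> * int s)))"
      using n by simp
    also have "\<dots> = (\<Sum>j<n\<^sub>\<alpha>. \<Sum>l = 1..g. of_real (d ((l - 1) * n\<^sub>\<alpha> + j)) *
        unity_power n (int ((l - 1) * n\<^sub>\<alpha> + j) * (int \<alpha> * int t - int \<alpha> * int s)))"
      by (rule sum_by_residue)
    also have "\<dots> = (\<Sum>j<n\<^sub>\<alpha>. of_real ((\<sigma> j)\<^sup>2) * unity_power n (int (h j) * (int t - int s)))"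
      by (intro sum.cong refl) (simp only: collapse \<sigma>_sq lessThan_iff if_True of_real_sum sum_distrib_right)
    \<comment> \<open>The added terms vanish, but they complete the sum to one over all
      \<open>n\<close> basis vectors, which gives 0 its multiplicity.\<close>
    also have "\<dots> = (\<Sum>j<n. of_real ((\<sigma> j)\<^sup>2) * unity_power n (int (h j) * (int t - int s)))"
      using \<open>n\<^sub>\<alpha> \<le> n\<close> by (intro sum.mono_neutral_left) (auto simp: \<sigma>_sq)
    finally show ?thesis
      by (simp only: adjoint_alpha_circulant_mult[OF \<open>s < n\<close> \<open>t < n\<close>])
  qed
  have "?A \<in> carrier_mat n n"
    by (intro carrier_matI) simp_all
  moreover have "inj_on h {..<n}" "h ` {..<n} \<subseteq> {..<n}"
    using h(1) by (simp_all add: bij_betw_def)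
  ultimately have "proots (char_poly ?A) = {# complex_of_real ((\<sigma> j)\<^sup>2). j \<in># mset_set {0..<n} #}"
    using \<open>n > 0\<close> entries by (intro proots_char_poly_fourier_diagonal)
  moreover have "\<sigma> j \<ge> 0" for j
    by (simp add: \<sigma>_def d_nonneg sum_nonneg)
  ultimately show ?thesis
    by (auto simp: is_singular_values_def multiset.map_comp comp_def)
qed

end
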